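(* Let $N\ge 2$ be an integer, $K,\mu,\omega_M>0$ with $\omega_M/K\le 1$, $\tau\ge 0$, and let $\phi^*\in\{\phi^+,\phi^-\}$. Let $\triangle(\lambda,\tau)\in \mathbb{C}^{2N\times 2N}$ be the characteristic matrix of the linearization of the full-phase model at the equilibrium $\phi_1=\dots=\phi_N=\phi^*$. Put $$q=K\mu(1-\cos(2\phi^* )),\qquad r=-\frac{K\mu}{N-1}(1+\cos(2\phi^* ))e^{-\lambda\tau}.$$ Then for all $\lambda\in\mathbb{C}$ $$\det\triangle(\lambda,\tau)=P_{\mathrm{Fix}}(\lambda,\tau)\,\bigl(P_U(\lambda,\tau)\bigr)^{N-1},$$ where $$P_{\mathrm{Fix}}(\lambda,\tau)=\lambda^2+\mu\lambda+q+(N-1)r,\qquad P_U(\lambda,\tau)=\lambda^2+\mu\lambda+q-r.$$ Here $P_{\mathrm{Fix}}(\lambda,\tau)$ is the determinant of the restriction of $\triangle(\lambda,\tau)$ to the subspace $V_0$ and, for each $j=1,\dots,N-1$, $P_U(\lambda,\tau)$ is the determinant of the restriction of $\triangle(\lambda,\tau)$ to the subspace $V_j$.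
   Context: The full-phase model is the system of delay differential equations $$\ddot\phi_i(t)+\mu\dot\phi_i(t)-\mu\omega_M=\frac{K\mu}{N-1}\sum_{j=1,\,j\ne i}^N\bigl[\sin(\phi_j(t-\tau)-\phi_i(t))+\sin(\phi_j(t-\tau)+\phi_i(t))\bigr],\quad i=1,\dots,N.$$ It has equilibria $\phi_1=\dots=\phi_N=\phi^{\pm}$ with $2\phi^+=\arcsin(-\omega_M/K)$ and $2\phi^-=\pi-\arcsin(-\omega_M/K)$ modulo $2\pi$, where $\arcsin$ takes values in $[-\pi/2,\pi/2]$. With $x=(x^{(1)},\dots,x^{(N)})\in\mathbb{R}^{2N}$, $x^{(i)}=(x^{(i)}_1,x^{(i)}_2)=(\phi_i,\dot\phi_i)$, the system is written in first order form $\dot x(t)=f(x(t),x(t-\tau))$. At the equilibrium $x^*$ given by $x^{(i)}=(\phi^*,0)$ for all $i$, let $A_0$ and $A_\tau$ be the Jacobians of $f$ with respect to its first and second argument at $(x^*,x^* )$. The characteristic matrix is $\triangle(\lambda,\tau)=\lambda\,\mathrm{Id}-A_0-A_\tau e^{-\lambda\tau}$. For $j=0,\dots,N-1$, $V_j\subset\mathbb{C}^{2N}=(\mathbb{C}^2)^N$ is the two-dimensional space of vectors $(v,\zeta^{j}v,\zeta^{2j}v,\dots,\zeta^{(N-1)j}v)$ with $v\in\mathbb{C}^2$ and $\zeta=e^{2\pi \mathrm{i}/N}$; in particular $V_0$ is the (complexified) fixed-point space of the action of the symmetric group permuting the $N$ blocks $x^{(i)}$. *)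

theory Defs
  imports "HOL-Analysis.Analysis"
begin

text \<open>
  The oscillators are indexed by a finite type \<open>'n\<close>, so \<open>N = CARD('n)\<close>. A state
  \<open>x \<in> \<real>\<^sup>2\<^sup>N\<close> has coordinates indexed by \<open>'n \<times> 2\<close>: \<open>x $ (i, 1)\<close> is the phase of oscillator \<open>i\<close>
  and \<open>x $ (i, 2)\<close> its velocity.
\<close>

text \<open>
  Right-hand side \<open>f(x(t), x(t - \<tau>))\<close> of the first order form; \<open>x\<close> is the current and \<open>y\<close> the
  delayed state.
\<close>

definition full_phase_rhs ::
  "real \<Rightarrow> real \<Rightarrow> real \<Rightarrow> real^('n::finite \<times> 2) \<Rightarrow> real^('n \<times> 2) \<Rightarrow> real^('n \<times> 2)" where
  "full_phase_rhs K \<mu> \<omega> x y = (\<chi> p. let i = fst p in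
     if snd p = 1 then x $ (i, 2)
     else - \<mu> * x $ (i, 2) + \<mu> * \<omega>
          + K * \<mu> / (real CARD('n) - 1) *
            (\<Sum>j \<in> UNIV - {i}. sin (y $ (j, 1) - x $ (i, 1)) + sin (y $ (j, 1) + x $ (i, 1))))"

definition is_phi_plus :: "real \<Rightarrow> real \<Rightarrow> real \<Rightarrow> bool" where
  "is_phi_plus K \<omega> \<phi> \<longleftrightarrow> (\<exists>k::int. 2 * \<phi> = arcsin (- \<omega> / K) + 2 * pi * of_int k)"

definition is_phi_minus :: "real \<Rightarrow> real \<Rightarrow> real \<Rightarrow> bool" where
  "is_phi_minus K \<omega> \<phi> \<longleftrightarrow> (\<exists>k::int. 2 * \<phi> = pi - arcsin (- \<omega> / K) + 2 * pi * of_int k)"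

definition sync_state :: "real \<Rightarrow> real^('n::finite \<times> 2)" where
  "sync_state \<phi> = (\<chi> p. if snd p = 1 then \<phi> else 0)"

text \<open>The synchronous state is an equilibrium, so it is legitimate to linearize there.\<close>

lemma full_phase_rhs_sync_state:
  assumes "CARD('n::finite) \<ge> 2" and "K > 0" and "\<omega> > 0" and "\<omega> / K \<le> 1"
    and "is_phi_plus K \<omega> \<phi> \<or> is_phi_minus K \<omega> \<phi>"
  shows "full_phase_rhs K \<mu> \<omega> (sync_state \<phi>) (sync_state \<phi> :: real^('n \<times> 2)) = 0"
proof -
  have range: "- 1 \<le> - \<omega> / K" "- \<omega> / K \<le> 1"
    using assms(2-4) by (auto simp: field_simps)
  have "sin (2 * \<phi>) = - \<omega> / K"
    using assms(5)
  proof
    assume "is_phi_plus K \<omega> \<phi>"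
    then obtain k :: int where "2 * \<phi> = arcsin (- \<omega> / K) + 2 * pi * of_int k"
      unfolding is_phi_plus_def by blast
    then show ?thesis
      using range by (simp only: sin_add sin_int_2pin cos_int_2pin) simp
  next
    assume "is_phi_minus K \<omega> \<phi>"
    then obtain k :: int where "2 * \<phi> = (pi - arcsin (- \<omega> / K)) + 2 * pi * of_int k"
      unfolding is_phi_minus_def by blast
    then show ?thesis
      using range by (simp only: sin_add sin_int_2pin cos_int_2pin) simp
  qed
  then have sin2: "sin (\<phi> + \<phi>) = - \<omega> / K"
    by (simp only: mult_2)
  have card: "real (card (UNIV - {i::'n})) = real CARD('n) - 1" "real CARD('n) - 1 \<noteq> 0" for i
    using assms(1) by (simp_all add: card_Diff_singleton)
  have "- \<mu> * 0 + \<mu> * \<omega> + K * \<mu> / (real CARD('n) - 1) *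
      (\<Sum>j \<in> UNIV - {i::'n}. sin (\<phi> - \<phi>) + sin (\<phi> + \<phi>)) = 0" for i
    unfolding sum_constant card sin2 using card(2) assms(2) by simp
  then show ?thesis
    by (simp only: full_phase_rhs_def sync_state_def vec_eq_iff Let_def vec_lambda_beta
        fst_conv snd_conv) simp
qed

definition jacobian_current :: "real \<Rightarrow> real \<Rightarrow> real \<Rightarrow> real \<Rightarrow> real^('n::finite \<times> 2)^('n \<times> 2)" where
  "jacobian_current K \<mu> \<omega> \<phi> =
     jacobian (\<lambda>x. full_phase_rhs K \<mu> \<omega> x (sync_state \<phi>)) (at (sync_state \<phi>))"

definition jacobian_delayed :: "real \<Rightarrow> real \<Rightarrow> real \<Rightarrow> real \<Rightarrow> real^('n::finite \<times> 2)^('n \<times> 2)" where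
  "jacobian_delayed K \<mu> \<omega> \<phi> =
     jacobian (\<lambda>y. full_phase_rhs K \<mu> \<omega> (sync_state \<phi>) y) (at (sync_state \<phi>))"

definition char_matrix ::
  "real \<Rightarrow> real \<Rightarrow> real \<Rightarrow> real \<Rightarrow> complex \<Rightarrow> real \<Rightarrow> complex^('n::finite \<times> 2)^('n \<times> 2)" where
  "char_matrix K \<mu> \<omega> \<phi> z \<tau> =
     mat z - map_matrix complex_of_real (jacobian_current K \<mu> \<omega> \<phi>)
           - map_matrix (\<lambda>a. complex_of_real a * exp (- z * complex_of_real \<tau>))
               (jacobian_delayed K \<mu> \<omega> \<phi>)"

definition q_coeff :: "real \<Rightarrow> real \<Rightarrow> real \<Rightarrow> real" where
  "q_coeff K \<mu> \<phi> = K * \<mu> * (1 - cos (2 * \<phi>))"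

definition r_coeff :: "nat \<Rightarrow> real \<Rightarrow> real \<Rightarrow> real \<Rightarrow> complex \<Rightarrow> real \<Rightarrow> complex" where
  "r_coeff N K \<mu> \<phi> z \<tau> =
     - complex_of_real (K * \<mu> / (real N - 1) * (1 + cos (2 * \<phi>)))
       * exp (- z * complex_of_real \<tau>)"

definition P_Fix :: "nat \<Rightarrow> real \<Rightarrow> real \<Rightarrow> real \<Rightarrow> complex \<Rightarrow> real \<Rightarrow> complex" where
  "P_Fix N K \<mu> \<phi> z \<tau> =
     z^2 + complex_of_real \<mu> * z + complex_of_real (q_coeff K \<mu> \<phi>)
     + (of_nat N - 1) * r_coeff N K \<mu> \<phi> z \<tau>"

definition P_U :: "nat \<Rightarrow> real \<Rightarrow> real \<Rightarrow> real \<Rightarrow> complex \<Rightarrow> real \<Rightarrow> complex" where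
  "P_U N K \<mu> \<phi> z \<tau> =
     z^2 + complex_of_real \<mu> * z + complex_of_real (q_coeff K \<mu> \<phi>) - r_coeff N K \<mu> \<phi> z \<tau>"

text \<open>
  The space \<open>V\<^sub>j\<close> of vectors \<open>(v, \<zeta>\<^sup>j v, \<dots>, \<zeta>\<^bsup>(N-1)j\<^esup> v)\<close>. As \<open>'n\<close> carries no order, the
  numbering of the blocks is an explicit argument \<open>idx\<close>, meant to be a bijection onto \<open>{..<N}\<close>.
\<close>

definition isotypic_space :: "('n::finite \<Rightarrow> nat) \<Rightarrow> nat \<Rightarrow> (complex^('n \<times> 2)) set" where
  "isotypic_space idx j =
     (let \<zeta> = exp (2 * complex_of_real pi * \<i> / of_nat CARD('n))
      in range (\<lambda>v::complex^2. \<chi> p. \<zeta> ^ (j * idx (fst p)) * v $ snd p))"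

definition is_basis_of :: "('m::finite \<Rightarrow> 'a::field^'k::finite) \<Rightarrow> ('a^'k) set \<Rightarrow> bool" where
  "is_basis_of b W \<longleftrightarrow> inj b \<and> vec.independent (range b) \<and> vec.span (range b) = W"

text \<open>\<open>C\<close> is the matrix, in the basis \<open>b\<close>, of the map \<open>v \<mapsto> M v\<close> restricted to the span of \<open>b\<close>.\<close>

definition represents_restriction ::
  "'a::field^'k::finite^'k \<Rightarrow> ('m::finite \<Rightarrow> 'a^'k) \<Rightarrow> 'a^'m^'m \<Rightarrow> bool" where
  "represents_restriction M b C \<longleftrightarrow> (\<forall>l. M *v b l = (\<Sum>k\<in>UNIV. (C $ k $ l) *s b k))"

text \<open>
  \<open>W\<close> is a two-dimensional \<open>M\<close>-invariant subspace and the restriction of \<open>M\<close> to \<open>W\<close> has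
  determinant \<open>d\<close>, computed in whichever basis of \<open>W\<close>.
\<close>

definition restriction_has_det2 ::
  "'a::field^'k::finite^'k \<Rightarrow> ('a^'k) set \<Rightarrow> 'a \<Rightarrow> bool" where
  "restriction_has_det2 M W d \<longleftrightarrow>
     (\<forall>v\<in>W. M *v v \<in> W) \<and>
     (\<exists>b :: 2 \<Rightarrow> 'a^'k. is_basis_of b W) \<and>
     (\<forall>(b :: 2 \<Rightarrow> 'a^'k) C. is_basis_of b W \<and> represents_restriction M b C \<longrightarrow> det C = d)"

end

theory Submission
  imports Defs
begin

text \<open>
  The characteristic matrix couples the blocks only through the sum over all other oscillators, so
  it acts on a mode \<open>(c\<^sub>i v)\<^sub>i\<close> with \<open>c\<^sub>i = \<zeta>\<^bsup>ji\<^esup>\<close> as a single 2 by 2 matrix: the sum of the \<open>c\<^sub>k\<close> with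
  \<open>k \<noteq> i\<close> is \<open>(N - 1) c\<^sub>i\<close> for \<open>j = 0\<close> and \<open>- c\<^sub>i\<close> otherwise. The Fourier matrix therefore conjugates
  it to a block diagonal matrix. The determinant of the latter is the product of those of its blocks
  because, over the complex numbers, unipotent lower triangular matrices conjugate all blocks to
  upper triangular form at once.
\<close>

section \<open>Sums over index pairs and entries of Jacobians\<close>

lemma sum_UNIV_prod_2:
  fixes f :: "'n::finite \<times> 2 \<Rightarrow> 'a::comm_monoid_add"
  shows "sum f UNIV = (\<Sum>i\<in>UNIV. f (i, 1) + f (i, 2))"
  using sum.cartesian_product [of "\<lambda>i a. f (i, a)" UNIV UNIV] by (simp add: sum_2)

lemma prod_UNIV_prod_2:
  fixes f :: "'n::finite \<times> 2 \<Rightarrow> 'a::comm_monoid_mult"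
  shows "prod f UNIV = (\<Prod>i\<in>UNIV. f (i, 1) * f (i, 2))"
  using prod.cartesian_product [of "\<lambda>i a. f (i, a)" UNIV UNIV] by (simp add: UNIV_2 flip: UNIV_Times_UNIV)

lemma has_derivative_vec_componentwise:
  fixes f :: "'a::real_normed_vector \<Rightarrow> real^'n::finite"
  assumes "\<And>i. ((\<lambda>x. f x $ i) has_derivative (\<lambda>h. f' h $ i)) (at a)"
  shows "(f has_derivative f') (at a)"
  using assms
  by (subst has_derivative_componentwise_within) (auto simp: Basis_vec_def inner_axis)

lemma jacobian_nth:
  assumes "(f has_derivative f') (at a)"
  shows "jacobian f (at a) $ p $ q = f' (axis q 1) $ p"
  using frechet_derivative_at [OF assms] by (simp add: jacobian_def matrix_def)

section \<open>Determinants of triangular and block diagonal matrices\<close>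

text \<open>\<open>rk\<close> takes the place of an order on the index type. A permutation preserves
  the sum of all ranks, so if it raises no rank it fixes every rank and is the identity. Every other
  permutation therefore meets a zero entry in the Leibniz formula.\<close>

lemma det_lower_triangular_ranked:
  fixes A :: "'a::comm_ring_1^'k^'k" and rk :: "'k::finite \<Rightarrow> nat"
  assumes rk: "inj rk" and A: "\<And>i j. rk i < rk j \<Longrightarrow> A $ i $ j = 0"
  shows "det A = (\<Prod>i\<in>UNIV. A $ i $ i)"
proof -
  let ?PU = "{p. p permutes (UNIV :: 'k set)}"
  have zero: "of_int (sign p) * (\<Prod>i\<in>UNIV. A $ i $ p i) = 0" if p: "p \<in> ?PU - {id}" for p
  proof -
    have "\<exists>i. rk i < rk (p i)"
    proof (rule ccontr)
      assume "\<nexists>i. rk i < rk (p i)"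
      then have le: "rk (p i) \<le> rk i" for i
        by (simp add: not_less)
      have "(\<Sum>i\<in>UNIV. rk (p i)) = (\<Sum>i\<in>UNIV. rk i)"
        using p by (intro sum.reindex_bij_betw) (auto simp: permutes_bij)
      then have "rk (p i) = rk i" for i
        using sum_mono_inv [of "\<lambda>i. rk (p i)" UNIV rk i] le by simp
      then have "p = id"
        using rk by (auto simp: inj_eq)
      then show False
        using p by simp
    qed
    then have "(\<Prod>i\<in>UNIV. A $ i $ p i) = 0"
      using A by (force intro: prod_zero)
    then show ?thesis
      by simp
  qed
  have "det A = (\<Sum>p\<in>{id}. of_int (sign p) * (\<Prod>i\<in>UNIV. A $ i $ p i))"
    unfolding det_def
    by (rule sum.mono_neutral_right) (use zero in \<open>auto simp: permutes_id finite_permutations\<close>)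
  then show ?thesis
    by (simp add: sign_id)
qed

lemma det_upper_triangular_ranked:
  fixes A :: "'a::comm_ring_1^'k^'k" and rk :: "'k::finite \<Rightarrow> nat"
  assumes "inj rk" and "\<And>i j. rk j < rk i \<Longrightarrow> A $ i $ j = 0"
  shows "det A = (\<Prod>i\<in>UNIV. A $ i $ i)"
  using det_lower_triangular_ranked [of rk "transpose A"] assms
  by (simp add: transpose_def det_transpose [of A, unfolded transpose_def])

definition block_diag :: "('n \<Rightarrow> 'a::zero^2^2) \<Rightarrow> 'a^('n::finite \<times> 2)^('n \<times> 2)" where
  "block_diag B = (\<chi> p q. if fst p = fst q then B (fst p) $ snd p $ snd q else 0)"

lemma block_diag_mult:
  fixes B C :: "'n::finite \<Rightarrow> 'a::semiring_1^2^2"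
  shows "block_diag B ** block_diag C = block_diag (\<lambda>i. B i ** C i)"
proof -
  have "(\<Sum>i\<in>UNIV. (if fst p = i then b i else 0) * (if i = fst q then c i else 0) +
             (if fst p = i then b' i else 0) * (if i = fst q then c' i else 0)) =
        (if fst p = fst q then b (fst p) * c (fst p) + b' (fst p) * c' (fst p) else 0)"
    for p q :: "'n \<times> 2" and b c b' c' :: "'n \<Rightarrow> 'a"
  proof -
    have "(\<Sum>i\<in>UNIV. (if fst p = i then b i else 0) * (if i = fst q then c i else 0) +
             (if fst p = i then b' i else 0) * (if i = fst q then c' i else 0)) =
          (\<Sum>i\<in>UNIV. if i = fst p then (if fst p = fst q then
              b (fst p) * c (fst p) + b' (fst p) * c' (fst p) else 0) else 0)"
      by (rule sum.cong) auto
    then show ?thesis by simp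
  qed
  then show ?thesis
    by (simp add: block_diag_def matrix_matrix_mult_def vec_eq_iff sum_UNIV_prod_2 sum_2)
qed

text \<open>This numbering runs through the pairs block by block, first component before second, so
  triangular blocks yield a triangular matrix. Parity recovers the component.\<close>

lemma inj_block_rank: "inj (\<lambda>p::'n::finite \<times> 2. 2 * to_nat_on UNIV (fst p) + (if snd p = 1 then 0 else 1))"
proof (rule injI)
  fix p q :: "'n \<times> 2"
  assume eq: "2 * to_nat_on UNIV (fst p) + (if snd p = 1 then 0 else 1) =
     2 * to_nat_on UNIV (fst q) + (if snd q = 1 then 0 else (1::nat))"
  have "snd p = 1 \<longleftrightarrow> snd q = 1"
    using arg_cong [OF eq, of even] by (auto split: if_splits)
  then have "to_nat_on UNIV (fst p) = to_nat_on UNIV (fst q)" "snd p = snd q"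
    using eq exhaust_2 [of "snd p"] exhaust_2 [of "snd q"] by auto
  then show "p = q"
    using inj_on_to_nat_on [of "UNIV :: 'n set"] by (auto dest: injD intro: prod_eqI simp: countable_finite)
qed

lemma det_block_diag_lower:
  fixes B :: "'n::finite \<Rightarrow> 'a::comm_ring_1^2^2"
  assumes "\<And>i. B i $ 1 $ 2 = 0"
  shows "det (block_diag B) = (\<Prod>i\<in>UNIV. det (B i))"
  using assms
  by (subst det_lower_triangular_ranked [OF inj_block_rank])
    (auto simp: block_diag_def prod_UNIV_prod_2 det_2 split: if_splits,
     metis exhaust_2)

lemma det_block_diag_upper:
  fixes B :: "'n::finite \<Rightarrow> 'a::comm_ring_1^2^2"
  assumes "\<And>i. B i $ 2 $ 1 = 0"
  shows "det (block_diag B) = (\<Prod>i\<in>UNIV. det (B i))"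
  using assms
  by (subst det_upper_triangular_ranked [OF inj_block_rank])
    (auto simp: block_diag_def prod_UNIV_prod_2 det_2 split: if_splits,
     metis exhaust_2)

lemma matrix_2_eq_iff:
  fixes A B :: "'a^2^2"
  shows "A = B \<longleftrightarrow> A$1$1 = B$1$1 \<and> A$1$2 = B$1$2 \<and> A$2$1 = B$2$1 \<and> A$2$2 = B$2$2"
  by (auto simp: vec_eq_iff forall_2)

text \<open>The hypothesis \<open>nz\<close> says that (0, 1) is not an eigenvector of any block, so
  an eigenvector can be scaled to have first coordinate 1.\<close>

lemma det_block_diag:
  fixes B :: "'n::finite \<Rightarrow> complex^2^2"
  assumes nz: "\<And>i. B i $ 1 $ 2 \<noteq> 0"
  shows "det (block_diag B) = (\<Prod>i\<in>UNIV. det (B i))"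
proof -
  \<comment> \<open>\<open>(1, w i)\<close> is an eigenvector of \<open>B i\<close>.\<close>
  define w where "w i = (B i $ 2 $ 2 - B i $ 1 $ 1 +
      csqrt ((B i $ 1 $ 1 - B i $ 2 $ 2)\<^sup>2 + 4 * B i $ 1 $ 2 * B i $ 2 $ 1)) / (2 * B i $ 1 $ 2)" for i
  \<comment> \<open>This is the quadratic equation b w^2 + (a - d) w - c = 0 for a block with rows
    (a, b) and (c, d). Below, \<open>s\<close> is the root of its discriminant, and completing the
    square yields the equation multiplied by 4 b.\<close>
  have w: "B i $ 2 $ 1 + B i $ 2 $ 2 * w i = w i * (B i $ 1 $ 1 + B i $ 1 $ 2 * w i)" for i
  proof -
    define s where "s = csqrt ((B i $ 1 $ 1 - B i $ 2 $ 2)\<^sup>2 + 4 * B i $ 1 $ 2 * B i $ 2 $ 1)"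
    have "s\<^sup>2 = (B i $ 1 $ 1 - B i $ 2 $ 2)\<^sup>2 + 4 * B i $ 1 $ 2 * B i $ 2 $ 1"
      by (simp add: s_def)
    moreover have "s = 2 * B i $ 1 $ 2 * w i - B i $ 2 $ 2 + B i $ 1 $ 1"
      using nz [of i] by (simp add: w_def s_def field_simps)
    ultimately have "4 * B i $ 1 $ 2 *
        (B i $ 2 $ 1 + B i $ 2 $ 2 * w i - w i * (B i $ 1 $ 1 + B i $ 1 $ 2 * w i)) = 0"
      by (simp add: power2_eq_square algebra_simps)
    then show ?thesis
      using nz [of i] by simp
  qed
  define W :: "'n \<Rightarrow> complex^2^2"
    where "W i = (\<chi> a b. if a = b then 1 else if b = 1 then w i else 0)" for i
  \<comment> \<open>\<open>T i\<close> is \<open>B i\<close> in the basis (1, w i), (0, 1), the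
    columns of \<open>W i\<close>; its upper left entry is the eigenvalue.\<close>
  define T :: "'n \<Rightarrow> complex^2^2"
    where "T i = (\<chi> a b. if b = 2 then (if a = 1 then B i $ 1 $ 2 else B i $ 2 $ 2 - w i * B i $ 1 $ 2)
        else if a = 1 then B i $ 1 $ 1 + B i $ 1 $ 2 * w i else 0)" for i
  have BW: "B i ** W i = W i ** T i" for i
    unfolding matrix_2_eq_iff using w [of i]
    by (simp add: W_def T_def matrix_matrix_mult_def sum_2)
  have detW: "det (W i) = 1" for i
    by (simp add: W_def det_2)
  have dW: "det (block_diag W) = 1"
    by (subst det_block_diag_lower) (simp_all add: detW, simp add: W_def)
  have "det (block_diag B) * det (block_diag W) = det (block_diag W) * det (block_diag T)"
    by (simp add: det_mul [symmetric] block_diag_mult BW)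
  then have "det (block_diag B) = det (block_diag T)"
    by (simp add: dW)
  also have "\<dots> = (\<Prod>i\<in>UNIV. det (T i))"
    by (rule det_block_diag_upper) (simp add: T_def)
  also have "\<dots> = (\<Prod>i\<in>UNIV. det (B i))"
  proof (rule prod.cong)
    show "det (T i) = det (B i)" for i
      using arg_cong [OF BW, of det i] by (simp add: det_mul detW)
  qed simp
  finally show ?thesis .
qed

section \<open>Determinant of the restriction to an invariant plane\<close>

text \<open>Passes from independence of a set to independence of a family: injectivity of
  \<open>b\<close> makes the coefficients a function on the range.\<close>

lemma independent_range_zero:
  fixes b :: "'m::finite \<Rightarrow> 'a::field^'k::finite"
  assumes "inj b" "vec.independent (range b)" "(\<Sum>l\<in>UNIV. u l *s b l) = 0"
  shows "u l = 0"
proof -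
  have "(\<Sum>v\<in>range b. u (inv b v) *s v) = 0"
    using assms by (simp add: sum.reindex inv_f_f)
  then have "u (inv b (b l)) = 0"
    by (intro vec.independentD [OF assms(2), of "range b"]) auto
  then show ?thesis
    using assms(1) by (simp add: inv_f_f)
qed

text \<open>The injection \<open>L\<close> is a coordinate system in which \<open>M\<close> acts as
  \<open>B\<close>. Any other basis differs from it by an invertible matrix \<open>Q\<close> with B
  Q = Q C, which forces equal determinants.\<close>

lemma restriction_has_det2I:
  fixes M :: "'a::field^'k::finite^'k" and L :: "'a^2 \<Rightarrow> 'a^'k"
  assumes lin: "Vector_Spaces.linear (*s) (*s) L" and inj: "inj L"
    and L_comm: "\<And>v. M *v L v = L (B *v v)"
  shows "restriction_has_det2 M (range L) (det B)"
  unfolding restriction_has_det2_def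
proof (intro conjI ballI allI impI)
  show "M *v v \<in> range L" if "v \<in> range L" for v
    using that L_comm by auto
next
  have ax: "range (\<lambda>k::2. axis k (1::'a)) = cart_basis"
    by (auto simp: cart_basis_def)
  have img: "range (\<lambda>k. L (axis k 1)) = L ` cart_basis"
    by (simp add: ax [symmetric] image_image)
  have "is_basis_of (\<lambda>k. L (axis k 1)) (range L)"
    unfolding is_basis_of_def img
  proof (intro conjI)
    show "inj (\<lambda>k. L (axis k 1))"
      by (rule injI) (auto dest!: injD [OF inj] simp: axis_eq_axis)
    show "vec.independent (L ` cart_basis)"
      using vec.linear_independent_injective_image [OF lin independent_cart_basis] inj
      by (simp add: span_cart_basis)
    show "vec.span (L ` cart_basis) = range L"
      by (simp add: vec.linear_span_image [OF lin] span_cart_basis)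
  qed
  then show "\<exists>b :: 2 \<Rightarrow> 'a^'k. is_basis_of b (range L)"
    by blast
next
  fix b :: "2 \<Rightarrow> 'a^'k" and C
  assume bC: "is_basis_of b (range L) \<and> represents_restriction M b C"
  then have b: "inj b" "vec.independent (range b)"
    and C: "\<And>l. M *v b l = (\<Sum>k\<in>UNIV. (C $ k $ l) *s b k)"
    by (auto simp: is_basis_of_def represents_restriction_def)
  have "range b \<subseteq> range L"
    using bC vec.span_superset [of "range b"] by (simp add: is_basis_of_def)
  then have "\<forall>l. \<exists>v. b l = L v"
    by blast
  then obtain c where c: "\<And>l. b l = L (c l)"
    by metis
  have L_sum: "L (\<Sum>k\<in>UNIV. u k *s c k) = (\<Sum>k\<in>UNIV. u k *s b k)" for u
    by (simp add: c vec.linear_sum [OF lin] vec.linear_scale [OF lin])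
  have Bc: "B *v c l = (\<Sum>k\<in>UNIV. (C $ k $ l) *s c k)" for l
    by (rule injD [OF inj]) (simp add: L_sum C [symmetric], simp add: c L_comm)
  \<comment> \<open>The columns of \<open>Q\<close> are the coordinates under \<open>L\<close> of
    the basis vectors \<open>b l\<close>.\<close>
  define Q where "Q = (\<chi> i l. c l $ i)"
  have "B ** Q = Q ** C"
    using Bc by (simp add: Q_def vec_eq_iff matrix_matrix_mult_def matrix_vector_mult_def mult.commute)
  then have "det B * det Q = det Q * det C"
    by (metis det_mul)
  \<comment> \<open>A kernel vector of \<open>Q\<close> would be a linear relation among the
    \<open>b l\<close>.\<close>
  moreover have "det Q \<noteq> 0"
  proof -
    have "x = 0" if "Q *v x = 0" for x
    proof -
      have "(\<Sum>k\<in>UNIV. x $ k *s c k) = 0"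
        using that by (simp add: Q_def vec_eq_iff matrix_vector_mult_def mult.commute)
      then have "(\<Sum>k\<in>UNIV. x $ k *s b k) = 0"
        using L_sum [of "\<lambda>k. x $ k"] vec.linear_0 [OF lin] by simp
      then show "x = 0"
        using independent_range_zero [OF b] by (simp add: vec_eq_iff)
    qed
    then show ?thesis
      by (metis matrix_left_invertible_ker invertible_left_inverse invertible_det_nz)
  qed
  ultimately show "det C = det B"
    by simp
qed

section \<open>Linearization of the full-phase model\<close>

text \<open>Closed form of the characteristic matrix. The delay is absorbed into \<open>r\<close>,
  so everything after the linearization is algebra in four complex parameters.\<close>

definition coupling_matrix :: "complex \<Rightarrow> complex \<Rightarrow> complex \<Rightarrow> complex \<Rightarrow> complex^('n::finite \<times> 2)^('n \<times> 2)"
  where "coupling_matrix z m q r = (\<chi> p k.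
    if snd p = 1 then (if k = (fst p, 1) then z else if k = (fst p, 2) then - 1 else 0)
    else if snd k = 2 then (if fst k = fst p then z + m else 0)
    else if fst k = fst p then q else r)"

lemmas has_derivative_vec_nth [derivative_intros] =
  bounded_linear.has_derivative [OF bounded_linear_vec_nth]

text \<open>At the synchronous state each summand has derivative - cos 0 + cos (2 \<phi>) with
  respect to the oscillator's own phase.\<close>

lemma jacobian_current_nth:
  assumes "CARD('n::finite) \<ge> 2"
  shows "(jacobian_current K \<mu> \<omega> \<phi> :: real^('n \<times> 2)^('n \<times> 2)) $ p $ k =
    (if snd p = 1 then (if k = (fst p, 2) then 1 else 0)
     else if k = (fst p, 2) then - \<mu>
     else if k = (fst p, 1) then - q_coeff K \<mu> \<phi>
     else 0)"
proof -
  let ?f' = "\<lambda>h :: real^('n \<times> 2). (\<chi> p. if snd p = 1 then h $ (fst p, 2)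
      else - \<mu> * h $ (fst p, 2) + K * \<mu> / (real CARD('n) - 1) *
        (\<Sum>j\<in>UNIV - {fst p}. (cos (2 * \<phi>) - 1) * h $ (fst p, 1)))"
  have "((\<lambda>x :: real^('n \<times> 2). full_phase_rhs K \<mu> \<omega> x (sync_state \<phi>)) has_derivative ?f')
      (at (sync_state \<phi>))"
  proof (rule has_derivative_vec_componentwise)
    fix p :: "'n \<times> 2"
    show "((\<lambda>x :: real^('n \<times> 2). full_phase_rhs K \<mu> \<omega> x (sync_state \<phi>) $ p)
        has_derivative (\<lambda>h. ?f' h $ p)) (at (sync_state \<phi>))"
    proof (cases "snd p = 1")
      case True
      then show ?thesis
        by (auto simp: full_phase_rhs_def intro!: derivative_eq_intros)
    next
      case False
      define c where "c = K * \<mu> / (real CARD('n) - 1)"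
      have cos2: "cos (2 * \<phi>) = cos (\<phi> + \<phi>)"
        by simp
      show ?thesis
        unfolding full_phase_rhs_def Let_def vec_lambda_beta
        using False unfolding cos2 c_def [symmetric]
        by (auto simp: sync_state_def algebra_simps sum_distrib_left sum.distrib sum_subtractf
            intro!: derivative_eq_intros sum.cong)
    qed
  qed
  note deriv = this
  \<comment> \<open>The N - 1 equal summands cancel the normalization 1 / (N - 1); N >= 2 makes this
    division legitimate.\<close>
  have coeff: "K * \<mu> / (real CARD('n) - 1) * ((real CARD('n) - 1) * (cos (2 * \<phi>) - 1)) =
      - q_coeff K \<mu> \<phi>"
    using assms by (simp add: q_coeff_def divide_simps) (simp add: algebra_simps)
  show ?thesis
    using exhaust_2 [of "snd p"] coeff assms jacobian_nth [OF deriv, of p k]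
    by (auto simp: jacobian_current_def axis_def prod_eq_iff card_Diff_singleton of_nat_diff)
qed

text \<open>Each delayed phase occurs in a single summand, with derivative cos 0 + cos (2 \<phi>),
  so here the factor 1 / (N - 1) survives.\<close>

lemma jacobian_delayed_nth:
  "(jacobian_delayed K \<mu> \<omega> \<phi> :: real^('n::finite \<times> 2)^('n \<times> 2)) $ p $ k =
    (if snd p = 2 \<and> snd k = 1 \<and> fst k \<noteq> fst p
     then K * \<mu> / (real CARD('n) - 1) * (1 + cos (2 * \<phi>)) else 0)"
proof -
  let ?f' = "\<lambda>h :: real^('n \<times> 2). (\<chi> p. if snd p = 1 then 0
      else K * \<mu> / (real CARD('n) - 1) * (\<Sum>j\<in>UNIV - {fst p}. (1 + cos (2 * \<phi>)) * h $ (j, 1)))"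
  have "((\<lambda>y :: real^('n \<times> 2). full_phase_rhs K \<mu> \<omega> (sync_state \<phi>) y) has_derivative ?f')
      (at (sync_state \<phi>))"
  proof (rule has_derivative_vec_componentwise)
    fix p :: "'n \<times> 2"
    show "((\<lambda>y :: real^('n \<times> 2). full_phase_rhs K \<mu> \<omega> (sync_state \<phi>) y $ p)
        has_derivative (\<lambda>h. ?f' h $ p)) (at (sync_state \<phi>))"
    proof (cases "snd p = 1")
      case True
      then show ?thesis
        by (auto simp: full_phase_rhs_def intro!: derivative_eq_intros)
    next
      case False
      define c where "c = K * \<mu> / (real CARD('n) - 1)"
      have cos2: "cos (2 * \<phi>) = cos (\<phi> + \<phi>)"
        by simp
      show ?thesis
        unfolding full_phase_rhs_def Let_def vec_lambda_beta
        using False unfolding cos2 c_def [symmetric]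
        by (auto simp: sync_state_def algebra_simps sum_distrib_left sum.distrib sum_subtractf
            intro!: derivative_eq_intros sum.cong)
    qed
  qed
  from jacobian_nth [OF this] show ?thesis
    using exhaust_2 [of "snd p"] exhaust_2 [of "snd k"]
    by (cases k) (auto simp: jacobian_delayed_def axis_def if_distrib [of "\<lambda>x. _ * x"] cong: if_cong)
qed

lemma char_matrix_eq_coupling_matrix:
  assumes "CARD('n::finite) \<ge> 2"
  shows "(char_matrix K \<mu> \<omega> \<phi> z \<tau> :: complex^('n \<times> 2)^('n \<times> 2)) =
    coupling_matrix z (of_real \<mu>) (of_real (q_coeff K \<mu> \<phi>)) (r_coeff CARD('n) K \<mu> \<phi> z \<tau>)"
proof -
  have "(char_matrix K \<mu> \<omega> \<phi> z \<tau> :: complex^('n \<times> 2)^('n \<times> 2)) $ (i, a) $ (j, b) =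
      coupling_matrix z (of_real \<mu>) (of_real (q_coeff K \<mu> \<phi>)) (r_coeff CARD('n) K \<mu> \<phi> z \<tau>)
        $ (i, a) $ (j, b)" for i j a b
    using exhaust_2 [of a] exhaust_2 [of b]
    by (auto simp: char_matrix_def coupling_matrix_def mat_def map_matrix_def r_coeff_def
        jacobian_current_nth [OF assms] jacobian_delayed_nth)
  then show ?thesis
    by (simp add: vec_eq_iff)
qed

lemma coupling_matrix_mult_vec:
  fixes x :: "complex^('n::finite \<times> 2)"
  shows "(coupling_matrix z m q r *v x) $ (i, a) =
    (if a = 1 then z * x $ (i, 1) - x $ (i, 2)
     else q * x $ (i, 1) + (z + m) * x $ (i, 2) + r * (\<Sum>j\<in>UNIV - {i}. x $ (j, 1)))"
proof (cases "a = 1")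
  case True
  have "(coupling_matrix z m q r *v x) $ (i, a) =
      (\<Sum>j\<in>UNIV. if j = i then z * x $ (i, 1) - x $ (i, 2) else 0)"
    using True unfolding matrix_vector_mult_def vec_lambda_beta
    by (subst sum_UNIV_prod_2, intro sum.cong) (auto simp: coupling_matrix_def)
  then show ?thesis
    using True by simp
next
  case False
  have "(coupling_matrix z m q r *v x) $ (i, a) =
      (\<Sum>j\<in>UNIV. if j = i then q * x $ (i, 1) + (z + m) * x $ (i, 2) else r * x $ (j, 1))"
    using False unfolding matrix_vector_mult_def vec_lambda_beta
    by (subst sum_UNIV_prod_2, intro sum.cong) (auto simp: coupling_matrix_def)
  also have "\<dots> = q * x $ (i, 1) + (z + m) * x $ (i, 2) + (\<Sum>j\<in>UNIV - {i}. r * x $ (j, 1))"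
    by (subst sum.remove [of UNIV i]) (auto intro!: sum.cong)
  finally show ?thesis
    using False by (simp add: sum_distrib_left)
qed

section \<open>Action on modes\<close>

text \<open>The tensor product of \<open>c\<close> and \<open>v\<close>; the spaces V_j are its
  ranges for \<open>c\<close> a character.\<close>

definition mode :: "('n::finite \<Rightarrow> complex) \<Rightarrow> complex^2 \<Rightarrow> complex^('n \<times> 2)" where
  "mode c v = (\<chi> p. c (fst p) * v $ snd p)"

text \<open>Characteristic matrix of the single oscillator x'' + m x' + s x = 0 in first order
  form.\<close>

definition mode_block :: "complex \<Rightarrow> complex \<Rightarrow> complex \<Rightarrow> complex^2^2" where
  "mode_block z m s = (\<chi> a b. if a = 1 then (if b = 1 then z else - 1) else (if b = 1 then s else z + m))"

lemma det_mode_block: "det (mode_block z m s) = z\<^sup>2 + m * z + s"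
  by (simp add: mode_block_def det_2 power2_eq_square algebra_simps)

lemma linear_mode: "Vector_Spaces.linear (*s) (*s) (mode c)"
  by unfold_locales (simp_all add: mode_def vec_eq_iff algebra_simps)

lemma inj_mode:
  assumes "c i \<noteq> 0"
  shows "inj (mode c)"
proof (rule injI)
  fix v w
  assume "mode c v = mode c w"
  then have "mode c v $ (i, a) = mode c w $ (i, a)" for a
    by simp
  then show "v = w"
    using assms by (simp add: mode_def vec_eq_iff)
qed

text \<open>The hypothesis makes \<open>c\<close> an eigenvector, with eigenvalue \<open>s\<close>,
  of the adjacency matrix of the complete graph. That matrix is the only interaction between blocks,
  so the coupling \<open>r\<close> reduces to \<open>s * r\<close>.\<close>

lemma coupling_matrix_mode:
  assumes "\<And>i. (\<Sum>j\<in>UNIV - {i}. c j) = s * c i"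
  shows "coupling_matrix z m q r *v mode c v = mode c (mode_block z m (q + s * r) *v v)"
proof -
  have "(coupling_matrix z m q r *v mode c v) $ (i, a) =
      mode c (mode_block z m (q + s * r) *v v) $ (i, a)" for i a
    using exhaust_2 [of a]
    unfolding coupling_matrix_mult_vec
    by (auto simp: mode_def mode_block_def matrix_vector_mult_def sum_2
        sum_distrib_right [symmetric] assms algebra_simps)
  then show ?thesis
    by (simp add: vec_eq_iff)
qed

section \<open>Characters of the cyclic group and the Fourier matrix\<close>

lemma sum_powers_root_of_unity:
  fixes x :: complex
  assumes "x ^ n = 1" "x \<noteq> 1"
  shows "(\<Sum>k<n. x ^ k) = 0"
  using assms by (simp add: geometric_sum)

context
  fixes idx :: "'n::finite \<Rightarrow> nat" and \<zeta> :: complex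
  assumes idx: "bij_betw idx UNIV {..<CARD('n)}"
    and \<zeta>: "\<zeta> = exp (2 * complex_of_real pi * \<i> / of_nat CARD('n))"
begin

lemma zeta_nonzero: "\<zeta> \<noteq> 0"
  by (simp add: \<zeta>)

lemma zeta_power: "\<zeta> ^ j = exp (2 * complex_of_real pi * \<i> * of_nat j / of_nat CARD('n))"
  by (simp add: \<zeta> exp_of_nat_mult [symmetric] mult_ac)

lemma zeta_power_card: "\<zeta> ^ (j * CARD('n)) = 1"
  by (simp add: zeta_power complex_root_unity power_mult)

lemma zeta_power_eq_iff:
  assumes "j < CARD('n)" "k < CARD('n)"
  shows "\<zeta> ^ j = \<zeta> ^ k \<longleftrightarrow> j = k"
  using assms complex_root_unity_eq [of "CARD('n)" j k] by (simp add: zeta_power)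

lemma idx_less: "idx i < CARD('n)"
  using idx by (auto simp: bij_betw_def)

lemma idx_eq_iff: "idx i = idx j \<longleftrightarrow> i = j"
  using idx by (auto simp: bij_betw_def inj_eq)

text \<open>Orthogonality of characters, with division in the role of conjugation. For distinct
  exponents the quotient is an N-th root of unity other than 1, and its powers sum to zero.\<close>

lemma sum_characters:
  assumes "j < CARD('n)" "k < CARD('n)"
  shows "(\<Sum>i\<in>UNIV. \<zeta> ^ (j * idx i) / \<zeta> ^ (k * idx i)) = (if j = k then of_nat CARD('n) else 0)"
proof -
  have "(\<Sum>i\<in>UNIV. \<zeta> ^ (j * idx i) / \<zeta> ^ (k * idx i)) = (\<Sum>i\<in>UNIV. (\<zeta> ^ j / \<zeta> ^ k) ^ idx i)"
    by (simp add: power_mult power_divide)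
  also have "\<dots> = (\<Sum>l<CARD('n). (\<zeta> ^ j / \<zeta> ^ k) ^ l)"
    by (rule sum.reindex_bij_betw [OF idx])
  also have "\<dots> = (if j = k then of_nat CARD('n) else 0)"
  proof (cases "j = k")
    case False
    have "(\<zeta> ^ j / \<zeta> ^ k) ^ CARD('n) = 1"
      by (simp add: power_divide zeta_power_card flip: power_mult)
    then show ?thesis
      using False assms zeta_nonzero
      by (simp add: sum_powers_root_of_unity zeta_power_eq_iff)
  qed (simp add: zeta_nonzero)
  finally show ?thesis .
qed

text \<open>Orthogonality to the trivial character evaluates the full sum; removing the term at
  \<open>i\<close> leaves the eigenvalues N - 1 and - 1 that separate \<open>P_Fix\<close> from
  \<open>P_U\<close>.\<close>

lemma sum_other_characters:
  assumes "j < CARD('n)"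
  shows "(\<Sum>k\<in>UNIV - {i}. \<zeta> ^ (j * idx k)) =
    (if j = 0 then of_nat CARD('n) - 1 else - 1) * \<zeta> ^ (j * idx i)"
proof -
  have "(\<Sum>k\<in>UNIV. \<zeta> ^ (j * idx k)) = (if j = 0 then of_nat CARD('n) else 0)"
    using sum_characters [OF assms, of 0] by simp
  then show ?thesis
    by (subst (asm) sum.remove [of UNIV i]) (auto simp: add_eq_0_iff eq_diff_eq add.commute)
qed

text \<open>The Fourier matrix tensored with the 2 by 2 identity: column \<open>(k, b)\<close> is
  the mode of character \<open>idx k\<close> and unit vector \<open>axis b 1\<close>.\<close>

definition fourier :: "complex^('n \<times> 2)^('n \<times> 2)" where
  "fourier = (\<chi> p k. if snd p = snd k then \<zeta> ^ (idx (fst k) * idx (fst p)) else 0)"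

lemma det_fourier_nonzero: "det fourier \<noteq> 0"
proof -
  \<comment> \<open>The conjugate transpose of \<open>fourier\<close>, hence its inverse up to the
    factor N.\<close>
  let ?H = "(\<chi> k p. if snd p = snd k then 1 / \<zeta> ^ (idx (fst k) * idx (fst p)) else 0)
    :: complex^('n \<times> 2)^('n \<times> 2)"
  have "(?H ** fourier) $ (k, a) $ (l, b) = mat (of_nat CARD('n)) $ (k, a) $ (l, b)" for k l a b
    using exhaust_2 [of a] exhaust_2 [of b] sum_characters [OF idx_less idx_less, of l k]
    by (auto simp: matrix_matrix_mult_def fourier_def sum_UNIV_prod_2 mat_def idx_eq_iff)
  then have "?H ** fourier = mat (of_nat CARD('n))"
    by (simp add: vec_eq_iff)
  then have "det ?H * det fourier = det (mat (of_nat CARD('n)) :: complex^('n \<times> 2)^('n \<times> 2))"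
    by (simp flip: det_mul)
  also have "\<dots> = of_nat CARD('n) ^ CARD('n \<times> 2)"
    by (subst det_diagonal) (simp_all add: mat_def)
  finally show ?thesis
    by auto
qed

text \<open>Column by column, \<open>comm\<close> says that \<open>M\<close> times
  \<open>fourier\<close> is \<open>fourier\<close> times a block diagonal matrix; the nonzero
  determinant of \<open>fourier\<close> then cancels.\<close>

lemma det_by_modes:
  fixes M :: "complex^('n \<times> 2)^('n \<times> 2)" and B :: "nat \<Rightarrow> complex^2^2"
  assumes comm: "\<And>j v. j < CARD('n) \<Longrightarrow>
      M *v mode (\<lambda>i. \<zeta> ^ (j * idx i)) v = mode (\<lambda>i. \<zeta> ^ (j * idx i)) (B j *v v)"
    and nz: "\<And>j. B j $ 1 $ 2 \<noteq> 0"
  shows "det M = (\<Prod>j<CARD('n). det (B j))"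
proof -
  let ?D = "block_diag (\<lambda>i. B (idx i)) :: complex^('n \<times> 2)^('n \<times> 2)"
  have "(M ** fourier) $ p $ (k, b) = (fourier ** ?D) $ p $ (k, b)" for p k b
  proof -
    let ?L = "mode (\<lambda>i. \<zeta> ^ (idx k * idx i))"
    have "(M ** fourier) $ p $ (k, b) = (M *v ?L (axis b 1)) $ p"
      by (simp add: matrix_matrix_mult_def matrix_vector_mult_def fourier_def mode_def axis_def
          if_distrib cong: if_cong)
    also have "\<dots> = ?L (B (idx k) *v axis b 1) $ p"
      by (simp add: comm idx_less)
    also have "\<dots> = \<zeta> ^ (idx k * idx (fst p)) * B (idx k) $ snd p $ b"
      by (simp add: mode_def matrix_vector_mult_def axis_def if_distrib cong: if_cong)
    also have "\<dots> = (fourier ** ?D) $ p $ (k, b)"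
      using exhaust_2 [of "snd p"]
      by (auto simp: matrix_matrix_mult_def fourier_def block_diag_def sum_UNIV_prod_2 if_distrib
            cong: if_cong)
    finally show ?thesis .
  qed
  then have "M ** fourier = fourier ** ?D"
    by (simp add: vec_eq_iff)
  then have "det M * det fourier = det fourier * det ?D"
    by (metis det_mul)
  then have "det M = (\<Prod>i\<in>UNIV. det (B (idx i)))"
    using det_fourier_nonzero by (simp add: det_block_diag nz)
  also have "\<dots> = (\<Prod>j<CARD('n). det (B j))"
    by (rule prod.reindex_bij_betw [OF idx])
  finally show ?thesis .
qed

lemma isotypic_space_eq_mode: "isotypic_space idx j = range (mode (\<lambda>i. \<zeta> ^ (j * idx i)))"
  by (simp add: isotypic_space_def mode_def [abs_def] \<zeta>)

end

section \<open>Factorization of the characteristic determinant\<close>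

theorem mainTheorem1:
  fixes K \<mu> \<omega> \<tau> \<phi> :: real
    and z :: complex
    and idx :: "'n::finite \<Rightarrow> nat"
  assumes "CARD('n) \<ge> 2"
    and "K > 0" and "\<mu> > 0" and "\<omega> > 0" and "\<omega> / K \<le> 1" and "\<tau> \<ge> 0"
    and "is_phi_plus K \<omega> \<phi> \<or> is_phi_minus K \<omega> \<phi>"
    and "bij_betw idx UNIV {..<CARD('n)}"
  shows "det (char_matrix K \<mu> \<omega> \<phi> z \<tau> :: complex^('n \<times> 2)^('n \<times> 2))
           = P_Fix CARD('n) K \<mu> \<phi> z \<tau> * P_U CARD('n) K \<mu> \<phi> z \<tau> ^ (CARD('n) - 1)
         \<and> restriction_has_det2 (char_matrix K \<mu> \<omega> \<phi> z \<tau>) (isotypic_space idx 0)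
             (P_Fix CARD('n) K \<mu> \<phi> z \<tau>)
         \<and> (\<forall>j\<in>{1..CARD('n) - 1}.
             restriction_has_det2 (char_matrix K \<mu> \<omega> \<phi> z \<tau>) (isotypic_space idx j)
               (P_U CARD('n) K \<mu> \<phi> z \<tau>))"
proof -
  let ?N = "CARD('n)"
  let ?M = "char_matrix K \<mu> \<omega> \<phi> z \<tau> :: complex^('n \<times> 2)^('n \<times> 2)"
  define \<zeta> where "\<zeta> = exp (2 * complex_of_real pi * \<i> / of_nat ?N)"
  note idx = \<open>bij_betw idx UNIV {..<?N}\<close>
  let ?L = "\<lambda>j. mode (\<lambda>i. \<zeta> ^ (j * idx i))"
  define B where "B j = mode_block z (of_real \<mu>) (of_real (q_coeff K \<mu> \<phi>) +
      (if j = 0 then of_nat ?N - 1 else - 1) * r_coeff ?N K \<mu> \<phi> z \<tau>)" for j :: nat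
  have comm: "?M *v ?L j v = ?L j (B j *v v)" if "j < ?N" for j v
    unfolding char_matrix_eq_coupling_matrix [OF assms(1)] B_def
    by (rule coupling_matrix_mode) (rule sum_other_characters [OF idx \<zeta>_def that])
  have det_B: "det (B j) = (if j = 0 then P_Fix ?N K \<mu> \<phi> z \<tau> else P_U ?N K \<mu> \<phi> z \<tau>)" for j
    by (simp add: B_def det_mode_block P_Fix_def P_U_def)
  \<comment> \<open>The upper right entry of every mode block is - 1, which supplies the
    nonvanishing condition.\<close>
  have "det ?M = (\<Prod>j<?N. det (B j))"
    by (rule det_by_modes [OF idx \<zeta>_def comm]) (simp_all add: B_def mode_block_def)
  \<comment> \<open>Writing N as a successor splits off the factor of frequency 0.\<close>
  also have "\<dots> = (\<Prod>j<Suc (?N - 1). det (B j))"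
    using assms(1) by simp
  also have "\<dots> = P_Fix ?N K \<mu> \<phi> z \<tau> * P_U ?N K \<mu> \<phi> z \<tau> ^ (?N - 1)"
    unfolding prod.lessThan_Suc_shift by (simp add: det_B)
  finally have det: "det ?M = \<dots>" .
  have restr: "restriction_has_det2 ?M (isotypic_space idx j) (det (B j))" if "j < ?N" for j
    unfolding isotypic_space_eq_mode [OF idx \<zeta>_def]
  proof (rule restriction_has_det2I [OF linear_mode])
    show "inj (?L j)"
      \<comment> \<open>Any index serves as witness, since powers of \<zeta> never vanish.\<close>
      by (rule inj_mode [of _ undefined]) (simp add: \<zeta>_def)
  qed (rule comm [OF that])
  show ?thesis
  proof (intro conjI ballI det)
    show "restriction_has_det2 ?M (isotypic_space idx 0) (P_Fix ?N K \<mu> \<phi> z \<tau>)"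
      using restr [of 0] by (simp add: det_B)
    show "restriction_has_det2 ?M (isotypic_space idx j) (P_U ?N K \<mu> \<phi> z \<tau>)"
      if "j \<in> {1..?N - 1}" for j
    proof -
      have "j < ?N" "j \<noteq> 0"
        using that assms(1) by auto
      then show ?thesis
        using restr [of j] by (simp add: det_B)
    qed
  qed
qed

end
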